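(* Let $(X,d_X)$ and $(T,d_T)$ be metric spaces, and let $S \subset X$ be a subset, considered as a metric space with the metric induced from $X$. If $f \colon S \to T$ is a pseudo-isometry, then the natural map $F \colon X \to \widehat{X}_f$ from $X$ to the surgered space $\widehat{X}_f$ is also a pseudo-isometry.
   Context: **Pseudo-isometry.** A map $g \colon A \to B$ between metric spaces $(A,d_A)$ and $(B,d_B)$ is a pseudo-isometry if there exist constants $K \geq 1$ and $C \geq 0$ such that: (1) for all $a_0,a_1 \in A$, $\frac{1}{K} d_A(a_0,a_1) - C \leq d_B(g(a_0),g(a_1)) \leq K d_A(a_0,a_1)$; and (2) for every $b \in B$ there is $a \in A$ with $d_B(g(a),b) \leq C$. **Admissible sequences.** Let $(X,d_X)$, $(T,d_T)$, $S\subset X$ and the pseudo-isometry $f \colon S \to T$ be as in the statement. An admissible sequence is a finite sequence of pairs $$\gamma : (x_0,y_1),(u_1,v_1),(x_1,y_2),\ldots,(u_k,v_k),(x_k,y_{k+1})$$ where $x_0,y_{k+1} \in X$; $x_i,y_i \in S$ for $i=1,\ldots,k$; $u_i,v_i \in T$ for $i=1,\ldots,k$; and $u_i = f(y_i)$, $v_i = f(x_i)$ for $i=1,\ldots,k$. Here $k \ge 0$, so that a single pair $(x_0,y_1)$ with $x_0,y_1\in X$ is allowed. The equalities $x_i=y_{i+1}$ and $u_i=v_i$ are allowed. The first pair $(x_0,y_1)$ may be omitted (when $k\ge 1$), in which case the only restriction on $u_1$ is $u_1 \in T$; likewise the last pair $(x_k,y_{k+1})$ may be omitted (when $k \ge 1$),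 in which case the only restriction on $v_k$ is $v_k \in T$. The sequence is said to be from $x_0$ to $y_{k+1}$, with $u_1$ replacing $x_0$ if the first pair is omitted and $v_k$ replacing $y_{k+1}$ if the last pair is omitted. Its length is $$\ell(\gamma) = d_X(x_0,y_1) + \sum_{i=1}^k \bigl(d_T(u_i,v_i) + d_X(x_i,y_{i+1})\bigr),$$ where the terms corresponding to omitted pairs are left out. **The surgered space.** Let $X \cup T$ denote the disjoint union of $X$ and $T$, let $X'$ be the quotient of $X \cup T$ by the equivalence relation generated by $s \sim f(s)$ for all $s \in S$, and let $j \colon X \cup T \to X'$ be the quotient map. Define the pseudo-metric $p_{X'}$ on $X'$ by letting $p_{X'}(x',y')$ be the infimum of $\ell(\gamma)$ over all admissible sequences $\gamma$ from some $x \in X \cup T$ to some $y \in X\cup T$ with $j(x)=x'$ and $j(y)=y'$. The metric space $(\widehat{X}_f,d_{\widehat{X}_f})$ is obtained from $(X',p_{X'})$ by identifying points at pseudo-distance $0$; with $q \colon X' \to \widehat{X}_f$ the quotient map, $d_{\widehat{X}_f}(\hat x,\hat y) = \inf\{p_{X'}(x',y') \mid q(x')=\hat x,\ q(y')=\hat y\}$. The natural map $F \colon X \to \widehat{X}_f$ is $F = q \circ j|_X$. *)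

theory Defs
  imports "HOL-Analysis.Abstract_Metric_Spaces"
begin

definition pseudo_isometry ::
  "'a set \<Rightarrow> ('a \<Rightarrow> 'a \<Rightarrow> real) \<Rightarrow> 'b set \<Rightarrow> ('b \<Rightarrow> 'b \<Rightarrow> real) \<Rightarrow> ('a \<Rightarrow> 'b) \<Rightarrow> bool"
  where "pseudo_isometry A dA B dB g \<longleftrightarrow>
    Metric_space A dA \<and> Metric_space B dB \<and> g \<in> A \<rightarrow> B \<and>
    (\<exists>K C. K \<ge> 1 \<and> C \<ge> 0 \<and>
      (\<forall>a0\<in>A. \<forall>a1\<in>A. (1 / K) * dA a0 a1 - C \<le> dB (g a0) (g a1) \<and>
                     dB (g a0) (g a1) \<le> K * dA a0 a1) \<and>
      (\<forall>b\<in>B. \<exists>a\<in>A. dB (g a) b \<le> C))"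

text \<open>
  An admissible sequence is a nonempty list in which pairs \<open>(x, y)\<close> of points of \<open>X\<close>
  and pairs \<open>(u, v)\<close> of points of \<open>T\<close> alternate. A list starting with a pair in \<open>T\<close> is a
  sequence whose first pair \<open>(x\<^sub>0, y\<^sub>1)\<close> is omitted, and a list ending with a pair in \<open>T\<close>
  is one whose last pair is omitted; so the case of both pairs omitted with no pair
  in \<open>T\<close> (the empty list) is excluded. The conditions \<open>u\<^sub>i = f y\<^sub>i\<close> and
  \<open>v\<^sub>i = f x\<^sub>i\<close>, with \<open>x\<^sub>i, y\<^sub>i \<in> S\<close>, relate neighbouring entries only, so outer
  endpoints are unrestricted in \<open>X\<close> or \<open>T\<close>.
\<close>

datatype ('a, 'b) seq_pair = XPair 'a 'a | TPair 'b 'b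

fun pair_in :: "'a set \<Rightarrow> 'b set \<Rightarrow> ('a, 'b) seq_pair \<Rightarrow> bool" where
  "pair_in X T (XPair x y) \<longleftrightarrow> x \<in> X \<and> y \<in> X"
| "pair_in X T (TPair u v) \<longleftrightarrow> u \<in> T \<and> v \<in> T"

fun compatible :: "'a set \<Rightarrow> ('a \<Rightarrow> 'b) \<Rightarrow> ('a, 'b) seq_pair \<Rightarrow> ('a, 'b) seq_pair \<Rightarrow> bool" where
  "compatible S f (XPair x y) (TPair u v) \<longleftrightarrow> y \<in> S \<and> u = f y"
| "compatible S f (TPair u v) (XPair x y) \<longleftrightarrow> x \<in> S \<and> v = f x"
| "compatible S f (XPair _ _) (XPair _ _) \<longleftrightarrow> False"
| "compatible S f (TPair _ _) (TPair _ _) \<longleftrightarrow> False"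

fun pair_src :: "('a, 'b) seq_pair \<Rightarrow> 'a + 'b" where
  "pair_src (XPair x y) = Inl x"
| "pair_src (TPair u v) = Inr u"

fun pair_tgt :: "('a, 'b) seq_pair \<Rightarrow> 'a + 'b" where
  "pair_tgt (XPair x y) = Inl y"
| "pair_tgt (TPair u v) = Inr v"

fun pair_len ::
  "('a \<Rightarrow> 'a \<Rightarrow> real) \<Rightarrow> ('b \<Rightarrow> 'b \<Rightarrow> real) \<Rightarrow> ('a, 'b) seq_pair \<Rightarrow> real" where
  "pair_len dX dT (XPair x y) = dX x y"
| "pair_len dX dT (TPair u v) = dT u v"

definition admissible_seq ::
  "'a set \<Rightarrow> 'b set \<Rightarrow> 'a set \<Rightarrow> ('a \<Rightarrow> 'b) \<Rightarrow> ('a, 'b) seq_pair list \<Rightarrow> bool"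
  where "admissible_seq X T S f \<gamma> \<longleftrightarrow>
    \<gamma> \<noteq> [] \<and> (\<forall>p\<in>set \<gamma>. pair_in X T p) \<and> successively (compatible S f) \<gamma>"

definition seq_from_to :: "('a, 'b) seq_pair list \<Rightarrow> 'a + 'b \<Rightarrow> 'a + 'b \<Rightarrow> bool"
  where "seq_from_to \<gamma> x y \<longleftrightarrow> pair_src (hd \<gamma>) = x \<and> pair_tgt (last \<gamma>) = y"

definition seq_length ::
  "('a \<Rightarrow> 'a \<Rightarrow> real) \<Rightarrow> ('b \<Rightarrow> 'b \<Rightarrow> real) \<Rightarrow> ('a, 'b) seq_pair list \<Rightarrow> real"
  where "seq_length dX dT \<gamma> = (\<Sum>p\<leftarrow>\<gamma>. pair_len dX dT p)"

definition glue_rel ::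
  "'a set \<Rightarrow> 'b set \<Rightarrow> 'a set \<Rightarrow> ('a \<Rightarrow> 'b) \<Rightarrow> (('a + 'b) \<times> ('a + 'b)) set"
  where "glue_rel X T S f =
    {(z, w). z \<in> X <+> T \<and> w \<in> X <+> T \<and>
             equivclp (\<lambda>a b. \<exists>s\<in>S. a = Inl s \<and> b = Inr (f s)) z w}"

definition glued_space ::
  "'a set \<Rightarrow> 'b set \<Rightarrow> 'a set \<Rightarrow> ('a \<Rightarrow> 'b) \<Rightarrow> ('a + 'b) set set"
  where "glued_space X T S f = (X <+> T) // glue_rel X T S f"

definition glue_map ::
  "'a set \<Rightarrow> 'b set \<Rightarrow> 'a set \<Rightarrow> ('a \<Rightarrow> 'b) \<Rightarrow> 'a + 'b \<Rightarrow> ('a + 'b) set"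
  where "glue_map X T S f z = glue_rel X T S f `` {z}"

text \<open>
  A real infimum, unspecified when no admissible sequence joins the two points. This does
  not occur if \<open>f : S \<rightarrow> T\<close> is a pseudo-isometry, as then \<open>S\<close> is nonempty whenever \<open>T\<close> is.
\<close>

definition glued_dist ::
  "'a set \<Rightarrow> ('a \<Rightarrow> 'a \<Rightarrow> real) \<Rightarrow> 'b set \<Rightarrow> ('b \<Rightarrow> 'b \<Rightarrow> real) \<Rightarrow> 'a set \<Rightarrow> ('a \<Rightarrow> 'b) \<Rightarrow>
   ('a + 'b) set \<Rightarrow> ('a + 'b) set \<Rightarrow> real"
  where "glued_dist X dX T dT S f x' y' =
    Inf {seq_length dX dT \<gamma> | \<gamma> x y.
           admissible_seq X T S f \<gamma> \<and> x \<in> X <+> T \<and> y \<in> X <+> T \<and> seq_from_to \<gamma> x y \<and>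
           glue_map X T S f x = x' \<and> glue_map X T S f y = y'}"

definition zero_dist_rel ::
  "'a set \<Rightarrow> ('a \<Rightarrow> 'a \<Rightarrow> real) \<Rightarrow> 'b set \<Rightarrow> ('b \<Rightarrow> 'b \<Rightarrow> real) \<Rightarrow> 'a set \<Rightarrow> ('a \<Rightarrow> 'b) \<Rightarrow>
   (('a + 'b) set \<times> ('a + 'b) set) set"
  where "zero_dist_rel X dX T dT S f =
    {(x', y'). x' \<in> glued_space X T S f \<and> y' \<in> glued_space X T S f \<and>
               glued_dist X dX T dT S f x' y' = 0}"

definition surgered_space ::
  "'a set \<Rightarrow> ('a \<Rightarrow> 'a \<Rightarrow> real) \<Rightarrow> 'b set \<Rightarrow> ('b \<Rightarrow> 'b \<Rightarrow> real) \<Rightarrow> 'a set \<Rightarrow> ('a \<Rightarrow> 'b) \<Rightarrow>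
   ('a + 'b) set set set"
  where "surgered_space X dX T dT S f = glued_space X T S f // zero_dist_rel X dX T dT S f"

definition surgered_quot ::
  "'a set \<Rightarrow> ('a \<Rightarrow> 'a \<Rightarrow> real) \<Rightarrow> 'b set \<Rightarrow> ('b \<Rightarrow> 'b \<Rightarrow> real) \<Rightarrow> 'a set \<Rightarrow> ('a \<Rightarrow> 'b) \<Rightarrow>
   ('a + 'b) set \<Rightarrow> ('a + 'b) set set"
  where "surgered_quot X dX T dT S f x' = zero_dist_rel X dX T dT S f `` {x'}"

text \<open>
  The value \<open>0\<close> off the carrier only serves the convention of \<^locale>\<open>Metric_space\<close>, which
  asks for nonnegativity and symmetry on the whole type.
\<close>

definition surgered_dist ::
  "'a set \<Rightarrow> ('a \<Rightarrow> 'a \<Rightarrow> real) \<Rightarrow> 'b set \<Rightarrow> ('b \<Rightarrow> 'b \<Rightarrow> real) \<Rightarrow> 'a set \<Rightarrow> ('a \<Rightarrow> 'b) \<Rightarrow>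
   ('a + 'b) set set \<Rightarrow> ('a + 'b) set set \<Rightarrow> real"
  where "surgered_dist X dX T dT S f xh yh =
    (if xh \<in> surgered_space X dX T dT S f \<and> yh \<in> surgered_space X dX T dT S f
     then Inf {glued_dist X dX T dT S f x' y' | x' y'.
                 x' \<in> glued_space X T S f \<and> y' \<in> glued_space X T S f \<and>
                 surgered_quot X dX T dT S f x' = xh \<and> surgered_quot X dX T dT S f y' = yh}
     else 0)"

definition surgery_map ::
  "'a set \<Rightarrow> ('a \<Rightarrow> 'a \<Rightarrow> real) \<Rightarrow> 'b set \<Rightarrow> ('b \<Rightarrow> 'b \<Rightarrow> real) \<Rightarrow> 'a set \<Rightarrow> ('a \<Rightarrow> 'b) \<Rightarrow>
   'a \<Rightarrow> ('a + 'b) set set"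
  where "surgery_map X dX T dT S f x =
    surgered_quot X dX T dT S f (glue_map X T S f (Inl x))"

end

theory Submission
  imports Defs
begin

text \<open>
  The upper bound and the coarse density of \<open>F\<close> are immediate: one pair \<open>(x, y)\<close> is an admissible
  sequence, and each point of \<open>T\<close> is within \<open>C\<close> of some \<open>f s\<close>, which is glued to \<open>s\<close>. The content
  is the lower bound. The danger is that comparing each pair \<open>(u\<^sub>i, v\<^sub>i)\<close> with \<open>(y\<^sub>i, x\<^sub>i)\<close>
  separately costs an additive error \<open>C\<close> each time, and a sequence has arbitrarily many such pairs.
  This is avoided by pushing the interior pairs of \<open>X\<close> into \<open>T\<close> instead. If \<open>x\<^sub>i, y\<^sub>i\<^sub>+\<^sub>1\<close> both lie
  in \<open>S\<close>, then \<open>dT (f x\<^sub>i) (f y\<^sub>i\<^sub>+\<^sub>1) \<le> K * dX x\<^sub>i y\<^sub>i\<^sub>+\<^sub>1\<close> with no additive error. So, up to a factor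
  \<open>K\<close>, the whole middle part of the sequence is replaced by one pair \<open>(f y\<^sub>1, f x\<^sub>k)\<close> of \<open>T\<close>, and the
  additive error is paid once: a sequence of length \<open>L\<close> from \<open>a\<close> to \<open>b\<close> has
  \<open>dX a b \<le> K\<^sup>2 * L + K * C\<close>. As \<open>K * C \<le> K\<^sup>2 * C\<close>, the map \<open>F\<close> is a
  pseudo-isometry with constants \<open>K\<^sup>2\<close> and \<open>C\<close>. Lemmas
  \<open>walk_lower_invariant\<close> and \<open>walk_lower_bound\<close> carry this out.

  The other ingredient is that distances in the surgered space can be computed on \<open>X <+> T\<close>.
  Admissible sequences must alternate, which makes concatenating them awkward, and those that define
  the glued distance start and end anywhere in a glue class. They are therefore replaced by walks,
  in which steps in \<open>X\<close>, steps in \<open>T\<close> and free moves between \<open>s\<close> and \<open>f s\<close> follow one another in any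
  order. The infimum of the costs of walks is plainly a pseudo-metric on \<open>X <+> T\<close>, it does not see
  the choice of a representative, and it equals the glued distance (\<open>glued_dist_eq\<close>) and then the
  surgered distance (\<open>surgered_dist_eq\<close>).
\<close>

locale surgery =
  X: Metric_space X dX + T: Metric_space T dT
  for X :: "'a set" and dX and T :: "'b set" and dT +
  fixes S :: "'a set" and f :: "'a \<Rightarrow> 'b" and K C :: real
  assumes S_sub: "S \<subseteq> X"
    and f_in: "s \<in> S \<Longrightarrow> f s \<in> T"
    and K_ge_1: "K \<ge> 1"
    and C_nonneg: "C \<ge> 0"
    and f_lower: "s \<in> S \<Longrightarrow> r \<in> S \<Longrightarrow> (1 / K) * dX s r - C \<le> dT (f s) (f r)"
    and f_upper: "s \<in> S \<Longrightarrow> r \<in> S \<Longrightarrow> dT (f s) (f r) \<le> K * dX s r"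
    and f_dense: "t \<in> T \<Longrightarrow> \<exists>s\<in>S. dT (f s) t \<le> C"
begin

lemma S_in_X: "s \<in> S \<Longrightarrow> s \<in> X"
  using S_sub by blast

section \<open>Walks and admissible sequences\<close>

inductive walk :: "'a + 'b \<Rightarrow> 'a + 'b \<Rightarrow> real \<Rightarrow> bool" for z where
  nil: "z \<in> X <+> T \<Longrightarrow> walk z z 0"
| X_step: "walk z (Inl x) L \<Longrightarrow> y \<in> X \<Longrightarrow> walk z (Inl y) (L + dX x y)"
| T_step: "walk z (Inr u) L \<Longrightarrow> v \<in> T \<Longrightarrow> walk z (Inr v) (L + dT u v)"
| into_T: "walk z (Inl s) L \<Longrightarrow> s \<in> S \<Longrightarrow> walk z (Inr (f s)) L"
| into_X: "walk z (Inr (f s)) L \<Longrightarrow> s \<in> S \<Longrightarrow> walk z (Inl s) L"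

lemma walk_in:
  assumes "walk z w L"
  shows "z \<in> X <+> T" "w \<in> X <+> T" "L \<ge> 0"
  using assms by (induction rule: walk.induct) (auto simp: S_in_X f_in)

lemma walk_trans:
  assumes "walk w u M" "walk z w L"
  shows "walk z u (L + M)"
  using assms
proof (induction rule: walk.induct)
  case nil
  then show ?case by simp
next
  case (X_step x M y)
  then show ?case using walk.X_step[of z x "L + M" y] by (simp add: add.assoc)
next
  case (T_step u M v)
  then show ?case using walk.T_step[of z u "L + M" v] by (simp add: add.assoc)
next
  case into_T
  then show ?case by (blast intro: walk.into_T)
next
  case into_X
  then show ?case by (blast intro: walk.into_X)
qed

lemma walk_X: "x \<in> X \<Longrightarrow> y \<in> X \<Longrightarrow> walk (Inl x) (Inl y) (dX x y)"
  using X_step[OF nil, of x y] by auto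

lemma walk_T: "u \<in> T \<Longrightarrow> v \<in> T \<Longrightarrow> walk (Inr u) (Inr v) (dT u v)"
  using T_step[OF nil, of u v] by auto

lemma walk_into_T: "s \<in> S \<Longrightarrow> walk (Inl s) (Inr (f s)) 0"
  by (rule into_T[OF nil]) (auto simp: S_in_X)

lemma walk_into_X: "s \<in> S \<Longrightarrow> walk (Inr (f s)) (Inl s) 0"
  by (rule into_X[OF nil]) (auto simp: f_in)

lemma walk_sym:
  assumes "walk z w L"
  shows "walk w z L"
  using assms
proof (induction rule: walk.induct)
  case nil
  then show ?case by (rule walk.nil)
next
  case (X_step x L y)
  then have "x \<in> X" by (auto dest: walk_in)
  with X_step have "walk (Inl y) (Inl x) (dX x y)"
    using walk_X[of y x] by (simp add: X.commute)
  from walk_trans[OF X_step.IH this] show ?case by (simp add: add.commute)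
next
  case (T_step u L v)
  then have "u \<in> T" by (auto dest: walk_in)
  with T_step have "walk (Inr v) (Inr u) (dT u v)"
    using walk_T[of v u] by (simp add: T.commute)
  from walk_trans[OF T_step.IH this] show ?case by (simp add: add.commute)
next
  case (into_T s L)
  from walk_trans[OF into_T.IH walk_into_X] into_T show ?case by simp
next
  case (into_X s L)
  from walk_trans[OF into_X.IH walk_into_T] into_X show ?case by simp
qed

text \<open>
  A point of \<open>T\<close> reaches \<open>X\<close> through \<open>S\<close>, which is nonempty as soon as \<open>T\<close> is because \<open>f\<close> is
  coarsely onto. So all infima below range over nonempty sets.
\<close>

lemma walk_exists:
  assumes "z \<in> X <+> T" "w \<in> X <+> T"
  shows "\<exists>L. walk z w L"
proof -
  have to_X: "\<exists>x\<in>X. \<exists>L. walk z (Inl x) L" if "z \<in> X <+> T" for z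
  proof (cases z)
    case (Inl x)
    with that show ?thesis by (auto intro: walk.nil)
  next
    case (Inr t)
    with that have "t \<in> T" by auto
    then obtain s where "s \<in> S" using f_dense by blast
    then have "walk (Inr t) (Inl s) (dT t (f s) + 0)"
      using \<open>t \<in> T\<close> by (intro walk_trans[OF walk_into_X walk_T] f_in)
    with \<open>s \<in> S\<close> S_in_X Inr show ?thesis by blast
  qed
  from to_X[OF assms(1)] to_X[OF assms(2)] obtain x y L M
    where "x \<in> X" "y \<in> X" "walk z (Inl x) L" "walk w (Inl y) M" by blast
  then show ?thesis
    using walk_trans[OF walk_sym walk_trans[OF walk_X]] by blast
qed

lemma admissible_snoc:
  "admissible_seq X T S f (\<gamma> @ [p]) \<longleftrightarrow>
    pair_in X T p \<and> (\<gamma> = [] \<or> admissible_seq X T S f \<gamma> \<and> compatible S f (last \<gamma>) p)"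
  by (auto simp: admissible_seq_def successively_append_iff)

lemma seq_length_snoc:
  "seq_length dX dT (\<gamma> @ [p]) = seq_length dX dT \<gamma> + pair_len dX dT p"
  by (simp add: seq_length_def)

lemma walk_of_pair:
  "pair_in X T p \<Longrightarrow> walk (pair_src p) (pair_tgt p) (pair_len dX dT p)"
  by (cases p) (auto intro: walk_X walk_T)

lemma walk_of_compatible:
  "compatible S f p q \<Longrightarrow> walk (pair_tgt p) (pair_src q) 0"
  by (cases p; cases q) (auto intro: walk_into_T walk_into_X)

lemma walk_of_admissible:
  assumes "admissible_seq X T S f \<gamma>"
  shows "walk (pair_src (hd \<gamma>)) (pair_tgt (last \<gamma>)) (seq_length dX dT \<gamma>)"
proof -
  have "\<gamma> \<noteq> []" using assms by (simp add: admissible_seq_def)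
  then show ?thesis using assms
  proof (induction rule: rev_nonempty_induct)
    case (single p)
    then show ?case
      by (simp add: admissible_seq_def seq_length_def walk_of_pair)
  next
    case (snoc p \<gamma>)
    then have "walk (pair_src (hd \<gamma>)) (pair_tgt (last \<gamma>)) (seq_length dX dT \<gamma>)"
      "compatible S f (last \<gamma>) p" "pair_in X T p"
      by (auto simp: admissible_snoc)
    then show ?case
      using walk_trans[OF walk_of_pair walk_trans[OF walk_of_compatible]] snoc.hyps
      by (fastforce simp: seq_length_snoc)
  qed
qed

text \<open>
  Conversely a walk is made to alternate by merging consecutive steps in the same space, which by
  the triangle inequality does not lengthen it, and by inserting a constant pair after a gluing move.
\<close>

lemma admissible_of_walk:
  assumes "walk z w L"
  shows "\<exists>\<gamma>. admissible_seq X T S f \<gamma> \<and> seq_from_to \<gamma> z w \<and> seq_length dX dT \<gamma> \<le> L"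
proof -
  have "\<exists>\<gamma> p. admissible_seq X T S f (\<gamma> @ [p]) \<and> pair_src (hd (\<gamma> @ [p])) = z \<and>
          pair_tgt p = w \<and> seq_length dX dT (\<gamma> @ [p]) \<le> L"
    using assms
  proof (induction rule: walk.induct)
    case nil
    show ?case
    proof (cases z)
      case (Inl x)
      with nil show ?thesis
        by (intro exI[of _ "[]"] exI[of _ "XPair x x"]) (auto simp: admissible_seq_def seq_length_def)
    next
      case (Inr t)
      with nil show ?thesis
        by (intro exI[of _ "[]"] exI[of _ "TPair t t"]) (auto simp: admissible_seq_def seq_length_def)
    qed
  next
    case (X_step x L y)
    then obtain \<gamma> p where \<gamma>: "admissible_seq X T S f (\<gamma> @ [p])" "pair_src (hd (\<gamma> @ [p])) = z"
      "pair_tgt p = Inl x" "seq_length dX dT (\<gamma> @ [p]) \<le> L" by blast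
    then obtain x0 where p: "p = XPair x0 x" by (cases p) auto
    with \<gamma> have x: "x0 \<in> X" "x \<in> X" by (auto simp: admissible_snoc)
    have "compatible S f q (XPair x0 y) = compatible S f q p" for q
      unfolding p by (cases q) auto
    moreover have "pair_src (hd (\<gamma> @ [XPair x0 y])) = pair_src (hd (\<gamma> @ [p]))"
      unfolding p by (cases \<gamma>) auto
    ultimately show ?case
      using \<gamma> p x X_step.hyps X.triangle[of x0 x y]
      by (intro exI[of _ \<gamma>] exI[of _ "XPair x0 y"]) (auto simp: admissible_snoc seq_length_snoc)
  next
    case (T_step u L v)
    then obtain \<gamma> p where \<gamma>: "admissible_seq X T S f (\<gamma> @ [p])" "pair_src (hd (\<gamma> @ [p])) = z"
      "pair_tgt p = Inr u" "seq_length dX dT (\<gamma> @ [p]) \<le> L" by blast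
    then obtain u0 where p: "p = TPair u0 u" by (cases p) auto
    with \<gamma> have u: "u0 \<in> T" "u \<in> T" by (auto simp: admissible_snoc)
    have "compatible S f q (TPair u0 v) = compatible S f q p" for q
      unfolding p by (cases q) auto
    moreover have "pair_src (hd (\<gamma> @ [TPair u0 v])) = pair_src (hd (\<gamma> @ [p]))"
      unfolding p by (cases \<gamma>) auto
    ultimately show ?case
      using \<gamma> p u T_step.hyps T.triangle[of u0 u v]
      by (intro exI[of _ \<gamma>] exI[of _ "TPair u0 v"]) (auto simp: admissible_snoc seq_length_snoc)
  next
    case (into_T s L)
    then obtain \<gamma> p where \<gamma>: "admissible_seq X T S f (\<gamma> @ [p])" "pair_src (hd (\<gamma> @ [p])) = z"
      "pair_tgt p = Inl s" "seq_length dX dT (\<gamma> @ [p]) \<le> L" by blast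
    then obtain x0 where p: "p = XPair x0 s" by (cases p) auto
    let ?q = "TPair (f s) (f s)"
    have "admissible_seq X T S f ((\<gamma> @ [p]) @ [?q])"
      using \<gamma>(1) into_T.hyps p by (subst admissible_snoc) (auto simp: f_in)
    moreover have "seq_length dX dT ((\<gamma> @ [p]) @ [?q]) \<le> L"
      using \<gamma>(4) into_T.hyps by (subst seq_length_snoc) (auto simp: f_in)
    moreover have "pair_src (hd ((\<gamma> @ [p]) @ [?q])) = z"
      using \<gamma>(2) by (metis hd_append2 snoc_eq_iff_butlast)
    ultimately show ?case by (intro exI[of _ "\<gamma> @ [p]"] exI[of _ ?q]) auto
  next
    case (into_X s L)
    then obtain \<gamma> p where \<gamma>: "admissible_seq X T S f (\<gamma> @ [p])" "pair_src (hd (\<gamma> @ [p])) = z"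
      "pair_tgt p = Inr (f s)" "seq_length dX dT (\<gamma> @ [p]) \<le> L" by blast
    then obtain u0 where p: "p = TPair u0 (f s)" by (cases p) auto
    let ?q = "XPair s s"
    have "admissible_seq X T S f ((\<gamma> @ [p]) @ [?q])"
      using \<gamma>(1) into_X.hyps p by (subst admissible_snoc) (auto simp: S_in_X)
    moreover have "seq_length dX dT ((\<gamma> @ [p]) @ [?q]) \<le> L"
      using \<gamma>(4) into_X.hyps by (subst seq_length_snoc) (auto simp: S_in_X)
    moreover have "pair_src (hd ((\<gamma> @ [p]) @ [?q])) = z"
      using \<gamma>(2) by (metis hd_append2 snoc_eq_iff_butlast)
    ultimately show ?case by (intro exI[of _ "\<gamma> @ [p]"] exI[of _ ?q]) auto
  qed
  then show ?thesis by (auto simp: seq_from_to_def)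
qed

section \<open>The lower bound\<close>

text \<open>
  Steps in \<open>X\<close> between two points of \<open>S\<close> are absorbed into the single \<open>T\<close>-term by \<open>f_upper\<close>; the
  weight \<open>1 / K\<close> on that term is what makes this possible. Once the walk has entered \<open>T\<close>, it
  suffices to remember the point \<open>s\<close> at which it first left \<open>X\<close> and the point \<open>r\<close> at which it last
  came back.
\<close>

lemma walk_lower_invariant:
  assumes "walk (Inl a) w L"
  shows "case w of
      Inl x \<Rightarrow> dX a x \<le> L \<or> (\<exists>s\<in>S. \<exists>r\<in>S. dX a s + dT (f s) (f r) / K + dX r x \<le> L)
    | Inr t \<Rightarrow> (\<exists>s\<in>S. dX a s + dT (f s) t / K \<le> L)"
  using assms
proof (induction rule: walk.induct)
  case nil
  then show ?case by auto
next
  case (X_step x L y)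
  then have x: "a \<in> X" "x \<in> X" by (auto dest: walk_in)
  have step: "dX b y \<le> dX b x + dX x y" if "b \<in> X" for b
    using X.triangle that x X_step.hyps by blast
  from X_step.IH consider "dX a x \<le> L"
    | s r where "s \<in> S" "r \<in> S" "dX a s + dT (f s) (f r) / K + dX r x \<le> L" by auto
  then show ?case
  proof cases
    case 1
    then show ?thesis using step[OF x(1)] by simp
  next
    case 2
    then have "dX a s + dT (f s) (f r) / K + dX r y \<le> L + dX x y"
      using step[of r] by (simp add: S_in_X)
    with 2 show ?thesis by auto
  qed
next
  case (T_step u L v)
  then have "u \<in> T" by (auto dest: walk_in)
  from T_step.IH obtain s where s: "s \<in> S" "dX a s + dT (f s) u / K \<le> L" by auto
  have "dT (f s) v / K \<le> (dT (f s) u + dT u v) / K"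
    using T.triangle \<open>u \<in> T\<close> T_step.hyps s f_in K_ge_1 by (intro divide_right_mono) auto
  also have "\<dots> \<le> dT (f s) u / K + dT u v"
    using K_ge_1 mult_left_mono[of 1 K "dT u v"] by (simp add: field_simps)
  finally show ?case using s by force
next
  case (into_T r L)
  from into_T.IH consider "dX a r \<le> L"
    | s q where "s \<in> S" "q \<in> S" "dX a s + dT (f s) (f q) / K + dX q r \<le> L" by auto
  then show ?case
  proof cases
    case 1
    then show ?thesis using into_T.hyps by (auto intro!: bexI[of _ r] simp: f_in)
  next
    case 2
    have "dT (f s) (f r) \<le> dT (f s) (f q) + dT (f q) (f r)"
      using 2 into_T.hyps f_in T.triangle by blast
    also have "\<dots> \<le> dT (f s) (f q) + K * dX q r"
      using f_upper 2 into_T.hyps by simp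
    finally have "dT (f s) (f r) / K \<le> dT (f s) (f q) / K + dX q r"
      using K_ge_1 by (simp add: field_simps)
    with 2 show ?thesis by force
  qed
next
  case (into_X r L)
  then obtain s where "s \<in> S" "dX a s + dT (f s) (f r) / K \<le> L" by auto
  moreover have "dX r r = 0" using into_X.hyps S_in_X by simp
  ultimately show ?case using into_X.hyps by force
qed

text \<open>The additive error enters here, through a single use of \<open>f_lower\<close>.\<close>

lemma walk_lower_bound:
  assumes "walk (Inl a) (Inl b) L"
  shows "(1 / K\<^sup>2) * dX a b - C \<le> L"
proof -
  have in_X: "a \<in> X" "b \<in> X" and L: "L \<ge> 0" using walk_in[OF assms] by auto
  have K: "K > 0" "K\<^sup>2 \<ge> 1" "K * C \<le> K\<^sup>2 * C"
    using K_ge_1 C_nonneg by (auto simp: self_le_power mult_right_mono)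
  from walk_lower_invariant[OF assms] consider "dX a b \<le> L"
    | s r where "s \<in> S" "r \<in> S" "dX a s + dT (f s) (f r) / K + dX r b \<le> L" by auto
  then have "dX a b \<le> K\<^sup>2 * L + K * C"
  proof cases
    case 1
    have "L \<le> K\<^sup>2 * L" using L K mult_right_mono[of 1 "K\<^sup>2" L] by simp
    moreover have "0 \<le> K * C" using K C_nonneg by simp
    ultimately show ?thesis using 1 by linarith
  next
    case 2
    have "dX a b \<le> dX a s + (dX s r + dX r b)"
      using X.triangle[of a s b] X.triangle[of s r b] 2 in_X S_in_X by fastforce
    moreover have "dX s r \<le> K\<^sup>2 * (dT (f s) (f r) / K) + K * C"
      using f_lower[of s r] 2 K by (simp add: field_simps power2_eq_square)
    moreover have "dX a s + dX r b \<le> K\<^sup>2 * (dX a s + dX r b)"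
      using K mult_right_mono[of 1 "K\<^sup>2" "dX a s + dX r b"] by simp
    ultimately have "dX a b \<le> K\<^sup>2 * (dX a s + dT (f s) (f r) / K + dX r b) + K * C"
      by (simp add: algebra_simps)
    also have "\<dots> \<le> K\<^sup>2 * L + K * C" using 2 by (simp add: mult_left_mono)
    finally show ?thesis .
  qed
  with K have "dX a b \<le> K\<^sup>2 * (L + C)" by (simp add: algebra_simps)
  with K show ?thesis by (simp add: field_simps)
qed

section \<open>The walk pseudo-metric\<close>

definition walk_dist :: "'a + 'b \<Rightarrow> 'a + 'b \<Rightarrow> real" where
  "walk_dist z w = Inf {L. walk z w L}"

lemma walk_costs_bdd_below: "bdd_below {L. walk z w L}"
  by (rule bdd_belowI[of _ 0]) (auto dest: walk_in)

lemma walk_dist_le: "walk z w L \<Longrightarrow> walk_dist z w \<le> L"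
  unfolding walk_dist_def by (rule cInf_lower[OF _ walk_costs_bdd_below]) simp

lemma walk_dist_greatest:
  assumes "z \<in> X <+> T" "w \<in> X <+> T" "\<And>L. walk z w L \<Longrightarrow> c \<le> L"
  shows "c \<le> walk_dist z w"
  unfolding walk_dist_def using walk_exists[OF assms(1,2)] assms(3) by (intro cInf_greatest) auto

lemma walk_dist_nonneg: "z \<in> X <+> T \<Longrightarrow> w \<in> X <+> T \<Longrightarrow> 0 \<le> walk_dist z w"
  by (rule walk_dist_greatest) (auto dest: walk_in)

lemma walk_dist_eq_0:
  assumes "walk z w 0"
  shows "walk_dist z w = 0"
  using walk_dist_le[OF assms] walk_dist_nonneg[of z w] walk_in[OF assms] by auto

lemma walk_dist_sym: "walk_dist z w = walk_dist w z"
proof -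
  have "{L. walk z w L} = {L. walk w z L}" using walk_sym by blast
  then show ?thesis by (simp add: walk_dist_def)
qed

lemma walk_dist_triangle:
  assumes "z \<in> X <+> T" "w \<in> X <+> T" "u \<in> X <+> T"
  shows "walk_dist z u \<le> walk_dist z w + walk_dist w u"
proof -
  have "walk_dist z u - L \<le> walk_dist w u" if "walk z w L" for L
    using walk_dist_le[OF walk_trans[OF _ that]] assms(2,3)
    by (intro walk_dist_greatest) force+
  then have "walk_dist z u - walk_dist w u \<le> walk_dist z w"
    using assms(1,2) by (intro walk_dist_greatest) force+
  then show ?thesis by simp
qed

lemma walk_dist_cong:
  assumes "z \<in> X <+> T" "z' \<in> X <+> T" "w \<in> X <+> T" "w' \<in> X <+> T"
    and "walk_dist z z' = 0" "walk_dist w w' = 0"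
  shows "walk_dist z w = walk_dist z' w'"
  using walk_dist_triangle[of z z' w] walk_dist_triangle[of z' w' w]
    walk_dist_triangle[of z' z w'] walk_dist_triangle[of z w w']
    walk_dist_sym[of z' z] walk_dist_sym[of w' w] assms by simp

section \<open>The glued space\<close>

lemma equiv_glue_rel: "equiv (X <+> T) (glue_rel X T S f)"
proof (rule equivI)
  show "sym (glue_rel X T S f)"
    unfolding glue_rel_def by (auto intro!: symI dest: equivclp_sym)
  show "trans (glue_rel X T S f)"
    unfolding glue_rel_def by (auto intro!: transI dest: transpD[OF transp_equivclp])
qed (auto simp: glue_rel_def refl_on_def)

lemma walk_of_equivclp:
  assumes "equivclp (\<lambda>a b. \<exists>s\<in>S. a = Inl s \<and> b = Inr (f s)) z w" "z \<in> X <+> T"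
  shows "walk z w 0"
  using assms
proof (induction rule: equivclp_induct)
  case base
  then show ?case by (rule walk.nil)
next
  case (step y w)
  then show ?case by (auto intro: walk.into_T walk.into_X)
qed

lemma glue_map_eq_iff:
  assumes "z \<in> X <+> T" "w \<in> X <+> T"
  shows "glue_map X T S f z = glue_map X T S f w \<longleftrightarrow> (z, w) \<in> glue_rel X T S f"
  unfolding glue_map_def by (rule eq_equiv_class_iff[OF equiv_glue_rel assms])

lemma walk_dist_glued:
  assumes "z \<in> X <+> T" "w \<in> X <+> T" "glue_map X T S f z = glue_map X T S f w"
  shows "walk_dist z w = 0"
  using assms glue_map_eq_iff
  by (auto simp: glue_rel_def intro!: walk_dist_eq_0 walk_of_equivclp)

lemma glued_space_eq: "glued_space X T S f = glue_map X T S f ` (X <+> T)"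
  by (auto simp: glued_space_def glue_map_def quotient_def)

text \<open>
  A sequence between other representatives of the two classes is no shortcut, because
  \<open>walk_dist\<close> does not distinguish glued points.
\<close>

lemma glued_dist_eq:
  assumes z: "z \<in> X <+> T" and w: "w \<in> X <+> T"
  shows "glued_dist X dX T dT S f (glue_map X T S f z) (glue_map X T S f w) = walk_dist z w"
proof -
  define A where "A = {seq_length dX dT \<gamma> | \<gamma> x y.
    admissible_seq X T S f \<gamma> \<and> x \<in> X <+> T \<and> y \<in> X <+> T \<and> seq_from_to \<gamma> x y \<and>
    glue_map X T S f x = glue_map X T S f z \<and> glue_map X T S f y = glue_map X T S f w}"
  have below: "walk_dist z w \<le> l" if "l \<in> A" for l
  proof -
    from that obtain \<gamma> x y where \<gamma>: "l = seq_length dX dT \<gamma>" "admissible_seq X T S f \<gamma>"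
      "x \<in> X <+> T" "y \<in> X <+> T" "seq_from_to \<gamma> x y"
      "glue_map X T S f x = glue_map X T S f z" "glue_map X T S f y = glue_map X T S f w"
      unfolding A_def by blast
    have "walk_dist z w = walk_dist x y"
      using \<gamma>(3,4,6,7) z w by (intro walk_dist_cong walk_dist_glued) simp_all
    also have "\<dots> \<le> l"
      using walk_of_admissible[OF \<gamma>(2)] \<gamma>(1,5) by (auto simp: seq_from_to_def intro: walk_dist_le)
    finally show ?thesis .
  qed
  then have bdd: "bdd_below A" by (rule bdd_belowI)
  have short: "\<exists>l\<in>A. l \<le> L" if "walk z w L" for L
  proof -
    from admissible_of_walk[OF that] obtain \<gamma> where
      "admissible_seq X T S f \<gamma>" "seq_from_to \<gamma> z w" "seq_length dX dT \<gamma> \<le> L" by blast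
    with z w show ?thesis unfolding A_def by blast
  qed
  then have "A \<noteq> {}" using walk_exists[OF z w] by blast
  then have "walk_dist z w \<le> Inf A" using below by (rule cInf_greatest)
  moreover have "Inf A \<le> walk_dist z w"
    using z w short by (intro walk_dist_greatest) (auto intro: cInf_lower2[OF _ _ bdd])
  ultimately show ?thesis by (simp add: glued_dist_def A_def)
qed

section \<open>The surgered space\<close>

definition surgery_point :: "'a + 'b \<Rightarrow> ('a + 'b) set set" where
  "surgery_point z = surgered_quot X dX T dT S f (glue_map X T S f z)"

lemma zero_dist_rel_iff:
  assumes "z \<in> X <+> T" "w \<in> X <+> T"
  shows "(glue_map X T S f z, glue_map X T S f w) \<in> zero_dist_rel X dX T dT S f \<longleftrightarrow>
    walk_dist z w = 0"
  using assms by (auto simp: zero_dist_rel_def glued_space_eq glued_dist_eq)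

lemma equiv_zero_dist_rel: "equiv (glued_space X T S f) (zero_dist_rel X dX T dT S f)"
proof (rule equivI)
  show "refl_on (glued_space X T S f) (zero_dist_rel X dX T dT S f)"
    unfolding refl_on_def glued_space_eq
    by (auto simp: zero_dist_rel_iff intro!: walk_dist_eq_0 walk.nil)
  show "sym (zero_dist_rel X dX T dT S f)"
    by (rule symI) (auto simp: zero_dist_rel_def glued_space_eq glued_dist_eq walk_dist_sym del: PlusE)
  show "trans (zero_dist_rel X dX T dT S f)"
  proof (rule transI)
    fix x y z
    assume 1: "(x, y) \<in> zero_dist_rel X dX T dT S f" and 2: "(y, z) \<in> zero_dist_rel X dX T dT S f"
    then have "x \<in> glued_space X T S f" "y \<in> glued_space X T S f" "z \<in> glued_space X T S f"
      by (auto simp: zero_dist_rel_def)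
    then obtain x' y' z' where
      p: "x' \<in> X <+> T" "y' \<in> X <+> T" "z' \<in> X <+> T" and
      e: "x = glue_map X T S f x'" "y = glue_map X T S f y'" "z = glue_map X T S f z'"
      unfolding glued_space_eq by blast
    from 1 2 have "walk_dist x' y' = 0" "walk_dist y' z' = 0"
      unfolding e using p by (simp_all add: zero_dist_rel_iff)
    then have "walk_dist x' z' = 0"
      using walk_dist_triangle[of x' y' z'] walk_dist_nonneg[of x' z'] p by simp
    then show "(x, z) \<in> zero_dist_rel X dX T dT S f"
      unfolding e using p by (simp add: zero_dist_rel_iff)
  qed
qed (auto simp: zero_dist_rel_def)

lemma surgery_point_eq_iff:
  assumes "z \<in> X <+> T" "w \<in> X <+> T"
  shows "surgery_point z = surgery_point w \<longleftrightarrow> walk_dist z w = 0"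
  unfolding surgery_point_def surgered_quot_def zero_dist_rel_iff[OF assms, symmetric]
  using assms by (intro eq_equiv_class_iff[OF equiv_zero_dist_rel]) (auto simp: glued_space_eq)

lemma surgered_space_eq: "surgered_space X dX T dT S f = surgery_point ` (X <+> T)"
  by (auto simp: surgered_space_def surgery_point_def surgered_quot_def quotient_def glued_space_eq)

text \<open>
  The infimum over representatives is one over a singleton, because \<open>walk_dist\<close> is constant on
  pairs of classes.
\<close>

lemma surgered_dist_eq:
  assumes z: "z \<in> X <+> T" and w: "w \<in> X <+> T"
  shows "surgered_dist X dX T dT S f (surgery_point z) (surgery_point w) = walk_dist z w"
proof -
  let ?A = "{glued_dist X dX T dT S f x' y' | x' y'.
    x' \<in> glued_space X T S f \<and> y' \<in> glued_space X T S f \<and>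
    surgered_quot X dX T dT S f x' = surgery_point z \<and>
    surgered_quot X dX T dT S f y' = surgery_point w}"
  have "l = walk_dist z w" if "l \<in> ?A" for l
  proof -
    from that obtain x y where "x \<in> X <+> T" "y \<in> X <+> T"
      "surgery_point z = surgery_point x" "surgery_point w = surgery_point y"
      "l = glued_dist X dX T dT S f (glue_map X T S f x) (glue_map X T S f y)"
      by (auto simp: glued_space_eq surgery_point_def del: PlusE)
    with z w show ?thesis
      using walk_dist_cong[of z x w y] by (simp add: glued_dist_eq surgery_point_eq_iff)
  qed
  moreover have "walk_dist z w \<in> ?A"
    using z w glued_dist_eq[OF z w, symmetric] unfolding glued_space_eq surgery_point_def by blast
  ultimately have "?A = {walk_dist z w}" by blast
  then show ?thesis using z w by (simp add: surgered_dist_def surgered_space_eq)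
qed

lemma Metric_space_surgered:
  "Metric_space (surgered_space X dX T dT S f) (surgered_dist X dX T dT S f)"
proof
  let ?M = "surgered_space X dX T dT S f" and ?d = "surgered_dist X dX T dT S f"
  show "0 \<le> ?d x y" for x y
  proof (cases "x \<in> ?M \<and> y \<in> ?M")
    case True
    then show ?thesis by (auto simp: surgered_space_eq surgered_dist_eq walk_dist_nonneg del: PlusE)
  qed (auto simp: surgered_dist_def)
  show "?d x y = ?d y x" for x y
  proof (cases "x \<in> ?M \<and> y \<in> ?M")
    case True
    then show ?thesis by (auto simp: surgered_space_eq surgered_dist_eq walk_dist_sym del: PlusE)
  qed (auto simp: surgered_dist_def)
  show "?d x y = 0 \<longleftrightarrow> x = y" if "x \<in> ?M" "y \<in> ?M" for x y
    using that by (auto simp: surgered_space_eq surgered_dist_eq del: PlusE simp flip: surgery_point_eq_iff)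
  show "?d x z \<le> ?d x y + ?d y z" if "x \<in> ?M" "y \<in> ?M" "z \<in> ?M" for x y z
    using that by (auto simp: surgered_space_eq surgered_dist_eq del: PlusE intro!: walk_dist_triangle)
qed

lemma surgery_map_eq: "surgery_map X dX T dT S f x = surgery_point (Inl x)"
  by (simp add: surgery_map_def surgery_point_def)

lemma surgery_map_coarsely_onto:
  assumes "b \<in> surgered_space X dX T dT S f"
  shows "\<exists>a\<in>X. surgered_dist X dX T dT S f (surgery_map X dX T dT S f a) b \<le> C"
proof -
  from assms obtain w where w: "w \<in> X <+> T" "b = surgery_point w"
    by (auto simp: surgered_space_eq)
  have "\<exists>a\<in>X. walk_dist (Inl a) w \<le> C"
  proof (cases w)
    case (Inl x)
    with w show ?thesis
      using walk_dist_eq_0[OF walk.nil, of w] C_nonneg by (auto intro!: bexI[of _ x])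
  next
    case (Inr t)
    with w have "t \<in> T" by auto
    with f_dense obtain s where s: "s \<in> S" "dT (f s) t \<le> C" by blast
    have "walk_dist (Inl s) w \<le> dT (f s) t"
      using walk_dist_le[OF walk_trans[OF walk_T walk_into_T]] s \<open>t \<in> T\<close> Inr f_in by simp
    with s S_in_X show ?thesis by force
  qed
  with w show ?thesis by (simp add: surgery_map_eq surgered_dist_eq InlI cong: bex_cong)
qed

lemma pseudo_isometry_surgery_map:
  "pseudo_isometry X dX (surgered_space X dX T dT S f) (surgered_dist X dX T dT S f)
     (surgery_map X dX T dT S f)"
proof -
  have lower: "(1 / K\<^sup>2) * dX a b - C \<le> walk_dist (Inl a) (Inl b)" if "a \<in> X" "b \<in> X" for a b
    using that walk_lower_bound by (intro walk_dist_greatest) auto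
  have "1 \<le> K\<^sup>2" using K_ge_1 by simp
  have upper: "walk_dist (Inl a) (Inl b) \<le> K\<^sup>2 * dX a b" if "a \<in> X" "b \<in> X" for a b
    using walk_dist_le[OF walk_X[OF that]] mult_right_mono[OF \<open>1 \<le> K\<^sup>2\<close>, of "dX a b"] by simp
  let ?F = "surgery_map X dX T dT S f" and ?d = "surgered_dist X dX T dT S f"
  have "\<forall>a\<in>X. \<forall>b\<in>X. (1 / K\<^sup>2) * dX a b - C \<le> ?d (?F a) (?F b) \<and> ?d (?F a) (?F b) \<le> K\<^sup>2 * dX a b"
    using lower upper by (simp add: surgery_map_eq surgered_dist_eq InlI)
  moreover have "?F \<in> X \<rightarrow> surgered_space X dX T dT S f"
    by (auto simp: surgery_map_eq surgered_space_eq)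
  ultimately show ?thesis
    unfolding pseudo_isometry_def
    using X.Metric_space_axioms Metric_space_surgered \<open>1 \<le> K\<^sup>2\<close> C_nonneg
      surgery_map_coarsely_onto by blast
qed

end

theorem theorem1p1:
  fixes X S :: "'a set" and dX :: "'a \<Rightarrow> 'a \<Rightarrow> real"
    and T :: "'b set" and dT :: "'b \<Rightarrow> 'b \<Rightarrow> real"
    and f :: "'a \<Rightarrow> 'b"
  assumes "Metric_space X dX" and "Metric_space T dT"
    and "S \<subseteq> X"
    and "pseudo_isometry S dX T dT f"
  shows "pseudo_isometry X dX (surgered_space X dX T dT S f) (surgered_dist X dX T dT S f)
           (surgery_map X dX T dT S f)"
proof -
  from assms(4) obtain K C where "f \<in> S \<rightarrow> T" "K \<ge> 1" "C \<ge> 0"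
    "\<forall>a0\<in>S. \<forall>a1\<in>S. (1 / K) * dX a0 a1 - C \<le> dT (f a0) (f a1) \<and> dT (f a0) (f a1) \<le> K * dX a0 a1"
    "\<forall>b\<in>T. \<exists>a\<in>S. dT (f a) b \<le> C"
    unfolding pseudo_isometry_def by blast
  with assms(1-3) interpret surgery X dX T dT S f K C
    by (intro surgery.intro surgery_axioms.intro) auto
  show ?thesis by (rule pseudo_isometry_surgery_map)
qed

end
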